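(* For every integer $g$, there exists a graph of girth at least $g$ that is not a Zykov graph (and therefore not a Blanche Descartes graph).
   Context: Zykov's construction: $Z_1$ is the graph with one vertex. Given $Z_1,\dots,Z_k$ ($k\ge 1$), the graph $Z_{k+1}$ is obtained by taking the disjoint union of $Z_1,\dots,Z_k$ and, for each $k$-tuple $(v_1,\dots,v_k)$ with $v_i\in V(Z_i)$, adding a new vertex adjacent exactly to $v_1,\dots,v_k$. A Zykov graph is any graph isomorphic to an induced subgraph of $Z_k$ for some $k\ge 1$. Blanche Descartes construction: $D_1$ is the one-vertex graph; if $D_k$ has been constructed and has $n$ vertices, $D_{k+1}$ is obtained by taking a stable set $S$ of $k(n-1)+1$ new vertices and, for each $n$-element subset $T$ of $S$, adding a new copy of $D_k$ together with a perfect matching between $T$ and the vertices of that copy (the matchings may be chosen arbitrarily). A Blanche Descartes graph is any graph isomorphic to an induced subgraph of some graph obtained after $k$ steps of this construction, for some $k\ge 1$. The girth of a graph is the length of its shortest cycle. *)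

theory Defs
  imports "Graph_Theory.Graph_Theory" "HOL-Library.Extended_Nat"
begin

text \<open>
  A finite simple graph is a \<^locale>\<open>pair_graph\<close>: a finite, symmetric and loop-free digraph without
  parallel arcs, where an edge is represented by its two orientations.
\<close>

text \<open>
  Arc-walk cycles include \<open>[(u, v), (v, u)]\<close> for every edge; all others in a loop-free graph have
  length at least 3 and are the cycles of the undirected graph. The infimum of the empty set is
  \<open>\<infinity>\<close>, so forests have infinite girth.
\<close>

definition girth :: "'a pair_pre_digraph \<Rightarrow> enat" where
  "girth G = (INF p \<in> {p. pre_digraph.cycle (with_proj G) p \<and> 3 \<le> length p}. enat (length p))"

definition iso_induced_subgraph :: "'a pair_pre_digraph \<Rightarrow> 'b pair_pre_digraph \<Rightarrow> bool" where
  "iso_induced_subgraph G H \<longleftrightarrow>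
    (\<exists>K. induced_subgraph K (with_proj H) \<and> digraph_iso (with_proj G) K)"

definition one_vertex_graph :: "'a \<Rightarrow> 'a pair_pre_digraph" where
  "one_vertex_graph v = \<lparr>pverts = {v}, parcs = {}\<rparr>"


section \<open>Zykov graphs\<close>

text \<open>
  In the step from \<open>[Z\<^sub>1, \<dots>, Z\<^sub>k]\<close> to \<open>Z\<^sub>k\<^sub>+\<^sub>1\<close>, the copy of \<open>v\<close> from the \<open>i\<close>-th list element (counting
  from 0) is \<open>ZCopy i v\<close>, and the new vertex for the tuple \<open>vs\<close> is \<open>ZTuple vs\<close>.
\<close>

datatype zykov_vertex = ZCopy nat zykov_vertex | ZTuple "zykov_vertex list"

definition transversals :: "'a set list \<Rightarrow> 'a list set" where
  "transversals Vs = {vs. length vs = length Vs \<and> (\<forall>i < length Vs. vs ! i \<in> Vs ! i)}"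

definition zykov_step :: "zykov_vertex pair_pre_digraph list \<Rightarrow> zykov_vertex pair_pre_digraph" where
  "zykov_step Zs =
    (let tuples = transversals (map pverts Zs);
         new_arcs = {(ZTuple vs, ZCopy i (vs ! i)) | vs i. vs \<in> tuples \<and> i < length Zs}
     in \<lparr>pverts = (\<Union>i < length Zs. ZCopy i ` pverts (Zs ! i)) \<union> ZTuple ` tuples,
         parcs = (\<Union>i < length Zs. map_prod (ZCopy i) (ZCopy i) ` parcs (Zs ! i))
           \<union> new_arcs \<union> new_arcs\<inverse>\<rparr>)"

text \<open>The graph \<open>Z\<^sub>k\<close> is \<open>zykov k\<close> for \<open>k \<ge> 1\<close>; the value at 0 is irrelevant.\<close>

fun zykov :: "nat \<Rightarrow> zykov_vertex pair_pre_digraph" where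
  "zykov k = (if k \<le> 1 then one_vertex_graph (ZTuple []) else zykov_step (map zykov [1..<k]))"

declare zykov.simps [simp del]

definition is_zykov_graph :: "'a pair_pre_digraph \<Rightarrow> bool" where
  "is_zykov_graph G \<longleftrightarrow> (\<exists>k \<ge> 1. iso_induced_subgraph G (zykov k))"


section \<open>Blanche Descartes graphs\<close>

text \<open>
  The vertices of the new stable set are \<open>DStable i\<close>, so its subsets are identified with sets \<open>T\<close> of
  indices; \<open>DCopy T v\<close> is the copy of \<open>v\<close> in the copy of the previous graph that is matched with \<open>T\<close>.
\<close>

datatype descartes_vertex = DStable nat | DCopy "nat set" descartes_vertex

definition descartes_subsets :: "nat \<Rightarrow> descartes_vertex pair_pre_digraph \<Rightarrow> nat set set" where
  "descartes_subsets k D =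
    (let n = card (pverts D) in {T. T \<subseteq> {..<k * (n - 1) + 1} \<and> card T = n})"

definition descartes_step :: "nat \<Rightarrow> descartes_vertex pair_pre_digraph \<Rightarrow>
    (nat set \<Rightarrow> nat \<Rightarrow> descartes_vertex) \<Rightarrow> descartes_vertex pair_pre_digraph" where
  "descartes_step k D m =
    (let Ts = descartes_subsets k D;
         matching_arcs = {(DStable i, DCopy T (m T i)) | T i. T \<in> Ts \<and> i \<in> T}
     in \<lparr>pverts = DStable ` {..<k * (card (pverts D) - 1) + 1} \<union> (\<Union>T \<in> Ts. DCopy T ` pverts D),
         parcs = (\<Union>T \<in> Ts. map_prod (DCopy T) (DCopy T) ` parcs D)
           \<union> matching_arcs \<union> matching_arcs\<inverse>\<rparr>)"

text \<open>
  \<open>descartes k D\<close> states that \<open>D\<close> is a possible \<open>D\<^sub>k\<close>. The bijection \<open>m T\<close> is the arbitrarily chosen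
  perfect matching between \<open>T\<close> and its copy.
\<close>

inductive descartes :: "nat \<Rightarrow> descartes_vertex pair_pre_digraph \<Rightarrow> bool" where
  one: "descartes 1 (one_vertex_graph (DStable 0))"
| step: "descartes (k + 1) (descartes_step k D m)"
    if "descartes k D" "\<And>T. T \<in> descartes_subsets k D \<Longrightarrow> bij_betw (m T) T (pverts D)"

definition is_blanche_descartes_graph :: "'a pair_pre_digraph \<Rightarrow> bool" where
  "is_blanche_descartes_graph G \<longleftrightarrow> (\<exists>k \<ge> 1. \<exists>D. descartes k D \<and> iso_induced_subgraph G D)"


section \<open>Well-formedness of the constructions\<close>

lemma pair_graphI:
  assumes "finite (pverts G)"
    and "\<And>u v. (u, v) \<in> parcs G \<Longrightarrow> u \<in> pverts G \<and> u \<noteq> v \<and> (v, u) \<in> parcs G"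
  shows "pair_graph G"
proof -
  have sub: "parcs G \<subseteq> pverts G \<times> pverts G"
  proof (rule subrelI)
    fix u v assume "(u, v) \<in> parcs G"
    then show "(u, v) \<in> pverts G \<times> pverts G"
      using assms(2)[of u v] assms(2)[of v u] by blast
  qed
  then have "finite (parcs G)"
    using assms(1) by (meson finite_SigmaI finite_subset)
  then show ?thesis
    using assms sub
    by unfold_locales (auto simp: symmetric_def intro!: symI)
qed

lemma pair_graphD:
  assumes "pair_graph G"
  shows "finite (pverts G)"
    and "(u, v) \<in> parcs G \<Longrightarrow> u \<in> pverts G \<and> v \<in> pverts G \<and> u \<noteq> v \<and> (v, u) \<in> parcs G"
proof -
  interpret pair_graph G by fact
  show "finite (pverts G)" by simp
  show "(u, v) \<in> parcs G \<Longrightarrow> u \<in> pverts G \<and> v \<in> pverts G \<and> u \<noteq> v \<and> (v, u) \<in> parcs G"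
    using arc_fst_in_verts[of "(u, v)"] arc_snd_in_verts[of "(u, v)"] pair_no_loops[of "(u, v)"]
      pair_sym_arcs by (auto simp: symmetric_def dest: symD)
qed

lemma pair_graph_one_vertex_graph: "pair_graph (one_vertex_graph v)"
  by (rule pair_graphI) (auto simp: one_vertex_graph_def)

lemma finite_transversals:
  assumes "\<forall>V \<in> set Vs. finite V"
  shows "finite (transversals Vs)"
proof (rule finite_subset)
  show "transversals Vs \<subseteq> {vs. set vs \<subseteq> \<Union> (set Vs) \<and> length vs = length Vs}"
    by (fastforce simp: transversals_def in_set_conv_nth)
  show "finite {vs. set vs \<subseteq> \<Union> (set Vs) \<and> length vs = length Vs}"
    using assms by (intro finite_lists_length_eq) auto
qed

lemma pair_graph_zykov_step:
  assumes "\<And>Z. Z \<in> set Zs \<Longrightarrow> pair_graph Z"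
  shows "pair_graph (zykov_step Zs)"
proof -
  have Z: "pair_graph (Zs ! i)" if "i < length Zs" for i
    using assms that by simp
  have nth: "vs ! i \<in> pverts (Zs ! i)"
    if "vs \<in> transversals (map pverts Zs)" "i < length Zs" for vs i
    using that by (simp add: transversals_def)
  show ?thesis
  proof (rule pair_graphI)
    have "finite (transversals (map pverts Zs))"
      using assms pair_graphD(1) by (intro finite_transversals) auto
    then show "finite (pverts (zykov_step Zs))"
      using pair_graphD(1)[OF Z] by (simp add: zykov_step_def Let_def)
  next
    fix u v assume "(u, v) \<in> parcs (zykov_step Zs)"
    then consider i x y where "i < length Zs" "(x, y) \<in> parcs (Zs ! i)" "u = ZCopy i x" "v = ZCopy i y"
      | vs i where "vs \<in> transversals (map pverts Zs)" "i < length Zs"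
          "(u, v) = (ZTuple vs, ZCopy i (vs ! i)) \<or> (v, u) = (ZTuple vs, ZCopy i (vs ! i))"
      by (auto simp: zykov_step_def Let_def)
    then show "u \<in> pverts (zykov_step Zs) \<and> u \<noteq> v \<and> (v, u) \<in> parcs (zykov_step Zs)"
    proof cases
      case 1
      then have "map_prod (ZCopy i) (ZCopy i) (y, x)
          \<in> (\<Union>i < length Zs. map_prod (ZCopy i) (ZCopy i) ` parcs (Zs ! i))"
        using pair_graphD(2)[OF Z] by blast
      then show ?thesis
        using 1 pair_graphD(2)[OF Z 1(2)] by (auto simp: zykov_step_def Let_def)
    next
      case 2
      then show ?thesis
        using nth by (auto simp: zykov_step_def Let_def)
    qed
  qed
qed

lemma pair_graph_zykov: "pair_graph (zykov k)"
proof (induction k rule: less_induct)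
  case (less k)
  have "pair_graph (zykov_step (map zykov [1..<k]))"
    using less by (intro pair_graph_zykov_step) auto
  then show ?case
    by (subst zykov.simps) (simp add: pair_graph_one_vertex_graph)
qed

lemma pair_graph_descartes:
  assumes "descartes k D"
  shows "pair_graph D"
  using assms
proof induction
  case one
  show ?case by (rule pair_graph_one_vertex_graph)
next
  case (step k D m)
  have "descartes_subsets k D \<subseteq> Pow {..<k * (card (pverts D) - 1) + 1}"
    by (auto simp: descartes_subsets_def Let_def)
  then have T: "T \<subseteq> {..<k * (card (pverts D) - 1) + 1}" "m T ` T \<subseteq> pverts D"
    if "T \<in> descartes_subsets k D" for T
    using that step.hyps(2) by (blast, metis bij_betw_imp_surj_on order_refl)
  show ?case
  proof (rule pair_graphI)
    have "finite (descartes_subsets k D)"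
      using \<open>descartes_subsets k D \<subseteq> _\<close> by (rule finite_subset) simp
    then show "finite (pverts (descartes_step k D m))"
      using pair_graphD(1)[OF step.IH] by (simp add: descartes_step_def Let_def)
  next
    fix u v assume "(u, v) \<in> parcs (descartes_step k D m)"
    then consider T x y where "T \<in> descartes_subsets k D" "(x, y) \<in> parcs D" "u = DCopy T x" "v = DCopy T y"
      | T i where "T \<in> descartes_subsets k D" "i \<in> T"
          "(u, v) = (DStable i, DCopy T (m T i)) \<or> (v, u) = (DStable i, DCopy T (m T i))"
      by (auto simp: descartes_step_def Let_def)
    then show "u \<in> pverts (descartes_step k D m) \<and> u \<noteq> v \<and> (v, u) \<in> parcs (descartes_step k D m)"
    proof cases
      case 1
      then have "map_prod (DCopy T) (DCopy T) (y, x)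
          \<in> (\<Union>T \<in> descartes_subsets k D. map_prod (DCopy T) (DCopy T) ` parcs D)"
        using pair_graphD(2)[OF step.IH] by blast
      then show ?thesis
        using 1 pair_graphD(2)[OF step.IH 1(2)] by (auto simp: descartes_step_def Let_def)
    next
      case 2
      then have "DStable i \<in> DStable ` {..<k * (card (pverts D) - 1) + 1}" "m T i \<in> pverts D"
        using T by blast+
      then show ?thesis
        using 2 by (auto simp: descartes_step_def Let_def)
    qed
  qed
qed

end

theory Submission
  imports Defs Complex_Main
begin

text \<open>
  The new vertices of one step of either construction form a stable set \<open>S\<close>, and a vertex of \<open>S\<close> has
  at most one neighbour in each of the copies that make up the rest of the graph. So every component
  of a graph in either class has a nonempty stable set \<open>S\<close> such that no vertex of \<open>S\<close> has two neighbours
  in the same component of the complement of \<open>S\<close>. It suffices to find a graph of large girth with a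
  nonempty induced subgraph \<open>U\<close> in which no nonempty stable set is of this kind.

  A sparse random graph, with one vertex deleted from each short cycle, has large girth, and any two
  disjoint vertex sets of size \<open>q\<close>, a small proportion of the vertices, are joined by an edge. Let \<open>W\<close> be
  a maximal set of at most \<open>6q\<close> vertices with at most \<open>|W|\<close> edges leaving it, and let \<open>U\<close> be its
  complement. If a stable set \<open>S\<close> of \<open>U\<close> were as above, then \<open>U - S\<close> would have a giant component \<open>K\<close>,
  at most \<open>|S|\<close> edges would lead from \<open>S\<close> to \<open>K\<close>, and \<open>V - K\<close> would contradict the maximality of \<open>W\<close>.
\<close>

section \<open>The obstruction\<close>

text \<open>Graphs are represented by an arc relation \<open>E\<close> and a vertex set
  \<open>U\<close>: passing to an induced subgraph only changes \<open>U\<close>, so the descent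
  through the constructions keeps \<open>E\<close> fixed.\<close>

definition zykov_obstruction :: "('a \<times> 'a) set \<Rightarrow> 'a set \<Rightarrow> bool" where
  "zykov_obstruction E U \<longleftrightarrow> U \<noteq> {} \<and>
    (\<forall>S \<subseteq> U. S \<noteq> {} \<longrightarrow> E \<inter> S \<times> S = {} \<longrightarrow>
      (\<exists>v \<in> S. \<exists>x \<in> U - S. \<exists>y \<in> U - S.
        x \<noteq> y \<and> (v, x) \<in> E \<and> (v, y) \<in> E \<and> (x, y) \<in> (Restr E (U - S))\<^sup>*))"

lemma zykov_obstructionE:
  assumes "zykov_obstruction E U" "S \<subseteq> U" "S \<noteq> {}" "E \<inter> S \<times> S = {}"
  obtains v x y where "v \<in> S" "x \<in> U - S" "y \<in> U - S" "x \<noteq> y" "(v, x) \<in> E" "(v, y) \<in> E"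
    "(x, y) \<in> (Restr E (U - S))\<^sup>*"
  using assms unfolding zykov_obstruction_def by blast

text \<open>A label that is constant on edges traps every path in one label class. Below,
  \<open>c\<close> names the copy containing a vertex.\<close>

lemma rtrancl_Restr_label:
  assumes "(x, y) \<in> (Restr E W)\<^sup>*"
    and "\<And>u v. (u, v) \<in> E \<Longrightarrow> u \<in> W \<Longrightarrow> v \<in> W \<Longrightarrow> c u = c v"
  shows "c x = c y \<and> (x, y) \<in> (Restr E {u \<in> W. c u = c x})\<^sup>*"
  using assms(1)
proof induction
  case base
  show ?case by simp
next
  case (step y z)
  then have "(y, z) \<in> Restr E {u \<in> W. c u = c x}"
    using assms(2)[of y z] by auto
  then show ?case
    using step by (auto intro: rtrancl_into_rtrancl)
qed

text \<open>The inductive step shared by both constructions: \<open>A\<close> holds the new stable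
  vertices, \<open>H\<close> the arcs, and \<open>c\<close> names the copy of an old vertex. The
  preimage of \<open>A\<close> is stable; were it nonempty, the obstruction would give a vertex of
  \<open>A\<close> two neighbours in one copy. With \<open>A\<close> avoided, every nonempty label
  class of \<open>U\<close> inherits the obstruction.\<close>

lemma zykov_obstruction_descend:
  assumes obs: "zykov_obstruction E U"
    and inj: "inj_on f U"
    and hom: "\<And>x y. x \<in> U \<Longrightarrow> y \<in> U \<Longrightarrow> (x, y) \<in> E \<Longrightarrow> (f x, f y) \<in> H"
    and stable: "H \<inter> A \<times> A = {}"
    and label: "\<And>p q. (p, q) \<in> H \<Longrightarrow> p \<notin> A \<Longrightarrow> q \<notin> A \<Longrightarrow> c p = c q"
    and uniq: "\<And>a p q. a \<in> A \<Longrightarrow> (a, p) \<in> H \<Longrightarrow> (a, q) \<in> H \<Longrightarrow> p \<notin> A \<Longrightarrow> q \<notin> A \<Longrightarrow> c p = c q \<Longrightarrow> p = q"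
  shows "\<exists>l. \<exists>U' \<subseteq> U. zykov_obstruction E U' \<and> (\<forall>x \<in> U'. f x \<notin> A \<and> c (f x) = l)"
proof -
  define S where "S = {x \<in> U. f x \<in> A}"
  have "S = {}"
  proof (rule ccontr)
    assume "S \<noteq> {}"
    moreover have "E \<inter> S \<times> S = {}"
      using hom stable by (fastforce simp: S_def)
    ultimately obtain v x y where v: "v \<in> S" "x \<in> U - S" "y \<in> U - S" "x \<noteq> y"
      "(v, x) \<in> E" "(v, y) \<in> E" "(x, y) \<in> (Restr E (U - S))\<^sup>*"
      using obs by (elim zykov_obstructionE[of E U S]) (auto simp: S_def)
    have "c (f x) = c (f y)"
      using rtrancl_Restr_label[OF v(7), of "c \<circ> f"] hom label by (auto simp: S_def)
    then have "f x = f y"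
      using v hom by (intro uniq[of "f v"]) (auto simp: S_def)
    then show False
      using v inj by (auto dest: inj_onD)
  qed
  then have notA: "f x \<notin> A" if "x \<in> U" for x
    using that by (auto simp: S_def)
  have edge: "c (f x) = c (f y)" if "x \<in> U" "y \<in> U" "(x, y) \<in> E" for x y
    using that hom label notA by blast
  obtain z where z: "z \<in> U"
    using obs by (auto simp: zykov_obstruction_def)
  \<comment> \<open>This class is closed under edges within \<open>U\<close>, so the neighbours that
    the obstruction on \<open>U\<close> supplies, and the path between them, stay inside it.\<close>
  define U' where "U' = {x \<in> U. c (f x) = c (f z)}"
  have "zykov_obstruction E U'"
    unfolding zykov_obstruction_def
  proof (intro conjI allI impI)
    show "U' \<noteq> {}"
      using z by (auto simp: U'_def)
    fix S assume S: "S \<subseteq> U'" "S \<noteq> {}" "E \<inter> S \<times> S = {}"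
    obtain v x y where v: "v \<in> S" "x \<in> U - S" "y \<in> U - S" "x \<noteq> y"
      "(v, x) \<in> E" "(v, y) \<in> E" "(x, y) \<in> (Restr E (U - S))\<^sup>*"
      using S by (rule_tac zykov_obstructionE[OF obs, of S]) (auto simp: U'_def)
    have in_U': "x \<in> U'" "y \<in> U'"
      using v S(1) edge[of v x] edge[of v y] by (auto simp: U'_def)
    moreover have "{u \<in> U - S. (c \<circ> f) u = (c \<circ> f) x} = U' - S"
      using in_U' by (auto simp: U'_def)
    then have "(x, y) \<in> (Restr E (U' - S))\<^sup>*"
      using rtrancl_Restr_label[OF v(7), of "c \<circ> f"] edge by simp
    ultimately show "\<exists>v\<in>S. \<exists>x\<in>U' - S. \<exists>y\<in>U' - S.
        x \<noteq> y \<and> (v, x) \<in> E \<and> (v, y) \<in> E \<and> (x, y) \<in> (Restr E (U' - S))\<^sup>*"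
      using v by blast
  qed
  then show ?thesis
    using notA by (intro exI[of _ "c (f z)"] exI[of _ U']) (auto simp: U'_def)
qed

section \<open>Excluding the obstruction from both constructions\<close>

lemma zykov_gt_1: "k > 1 \<Longrightarrow> zykov k = zykov_step (map zykov [1..<k])"
  by (subst zykov.simps) simp

text \<open>Each descent moves the obstruction into a copy of an earlier graph, which cannot go on
  forever. For \<open>k \<le> 1\<close> the only vertex is a \<open>ZTuple\<close>, so the descent
  leaves no vertices and the same step covers the base.\<close>

lemma not_zykov_obstruction_zykov:
  assumes "zykov_obstruction E U" "inj_on f U" "f ` U \<subseteq> pverts (zykov k)"
    and "\<And>x y. x \<in> U \<Longrightarrow> y \<in> U \<Longrightarrow> (x, y) \<in> E \<Longrightarrow> (f x, f y) \<in> parcs (zykov k)"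
  shows False
  using assms
proof (induction k arbitrary: f U rule: less_induct)
  case (less k)
  \<comment> \<open>The values at a \<open>ZTuple\<close> are arbitrary defaults: \<open>c\<close>
    and \<open>d\<close> matter only on vertices inside copies.\<close>
  define c where "c p = (case p of ZCopy i v \<Rightarrow> i | ZTuple vs \<Rightarrow> 0)" for p
  define d where "d p = (case p of ZCopy i v \<Rightarrow> v | ZTuple vs \<Rightarrow> p)" for p
  have arcs: "parcs (zykov k) \<inter> range ZTuple \<times> range ZTuple = {}"
    "(p, q) \<in> parcs (zykov k) \<Longrightarrow> p \<notin> range ZTuple \<Longrightarrow> q \<notin> range ZTuple \<Longrightarrow> c p = c q"
    "a \<in> range ZTuple \<Longrightarrow> (a, p) \<in> parcs (zykov k) \<Longrightarrow> (a, q) \<in> parcs (zykov k) \<Longrightarrow>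
      p \<notin> range ZTuple \<Longrightarrow> q \<notin> range ZTuple \<Longrightarrow> c p = c q \<Longrightarrow> p = q" for a p q
    by (cases "k > 1"; auto simp: zykov_gt_1[of k] zykov.simps[of k] zykov_step_def Let_def
        one_vertex_graph_def c_def)+
  have "\<exists>l. \<exists>U' \<subseteq> U. zykov_obstruction E U' \<and> (\<forall>x \<in> U'. f x \<notin> range ZTuple \<and> c (f x) = l)"
    by (rule zykov_obstruction_descend[OF less.prems(1,2,4) arcs])
  then obtain l U' where U': "U' \<subseteq> U" "zykov_obstruction E U'"
    "\<forall>x \<in> U'. f x \<notin> range ZTuple \<and> c (f x) = l"
    by blast
  \<comment> \<open>Position \<open>l\<close> of \<open>map zykov [1..<k]\<close> holds
    \<open>zykov (Suc l)\<close>, hence the shift.\<close>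
  have verts: "p \<in> ZCopy l ` pverts (zykov (Suc l)) \<and> Suc l < k"
    if "p \<in> pverts (zykov k)" "p \<notin> range ZTuple" "c p = l" for p
    using that by (cases "k > 1")
      (auto simp: zykov_gt_1[of k] zykov.simps[of k] zykov_step_def Let_def one_vertex_graph_def c_def)
  have fU': "f x \<in> ZCopy l ` pverts (zykov (Suc l)) \<and> Suc l < k" if "x \<in> U'" for x
    using that U' less.prems(3) by (intro verts) blast+
  have fx: "f x = ZCopy l (d (f x))" "d (f x) \<in> pverts (zykov (Suc l))" if "x \<in> U'" for x
    using fU'[OF that] by (auto simp: d_def)
  show False
  proof (rule less.IH)
    show "Suc l < k"
      using U'(2) fU' by (auto simp: zykov_obstruction_def)
    show "zykov_obstruction E U'"
      by fact
    show "inj_on (d \<circ> f) U'"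
      using inj_on_subset[OF less.prems(2) U'(1)] fx(1)
      by (auto simp: inj_on_def) metis
    show "(d \<circ> f) ` U' \<subseteq> pverts (zykov (Suc l))"
      using fx by auto
    show "((d \<circ> f) x, (d \<circ> f) y) \<in> parcs (zykov (Suc l))"
      if "x \<in> U'" "y \<in> U'" "(x, y) \<in> E" for x y
    proof -
      have "(ZCopy l (d (f x)), ZCopy l (d (f y))) \<in> parcs (zykov k)"
        using less.prems(4)[of x y] fx that U'(1) by auto
      then show ?thesis
        by (cases "k > 1")
          (auto simp: zykov_gt_1[of k] zykov.simps[of k] zykov_step_def Let_def one_vertex_graph_def)
    qed
  qed
qed

text \<open>The set \<open>T\<close> labels a copy, and a stable vertex is matched to at most one
  vertex in each copy.\<close>

lemma not_zykov_obstruction_descartes: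
  assumes "descartes k D"
    and "zykov_obstruction E U" "inj_on f U" "f ` U \<subseteq> pverts D"
    and "\<And>x y. x \<in> U \<Longrightarrow> y \<in> U \<Longrightarrow> (x, y) \<in> E \<Longrightarrow> (f x, f y) \<in> parcs D"
  shows False
  using assms
proof (induction arbitrary: f U)
  case one
  \<comment> \<open>With no arcs present, \<open>U\<close> itself is stable, and the choice
    \<open>S = U\<close> leaves no room for the two neighbours.\<close>
  have "E \<inter> U \<times> U = {}" "U \<noteq> {}"
    using one by (auto simp: one_vertex_graph_def zykov_obstruction_def)
  then show False
    by (rule_tac zykov_obstructionE[OF one(1) order_refl]) auto
next
  case (step k D m)
  define c where "c p = (case p of DCopy T v \<Rightarrow> T | DStable i \<Rightarrow> {})" for p
  define d where "d p = (case p of DCopy T v \<Rightarrow> v | DStable i \<Rightarrow> p)" for p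
  let ?D = "descartes_step k D m"
  have arcs: "parcs ?D \<inter> range DStable \<times> range DStable = {}"
    "(p, q) \<in> parcs ?D \<Longrightarrow> p \<notin> range DStable \<Longrightarrow> q \<notin> range DStable \<Longrightarrow> c p = c q"
    "a \<in> range DStable \<Longrightarrow> (a, p) \<in> parcs ?D \<Longrightarrow> (a, q) \<in> parcs ?D \<Longrightarrow>
      p \<notin> range DStable \<Longrightarrow> q \<notin> range DStable \<Longrightarrow> c p = c q \<Longrightarrow> p = q" for a p q
    by (auto simp: descartes_step_def Let_def c_def)
  have "\<exists>l. \<exists>U' \<subseteq> U. zykov_obstruction E U' \<and> (\<forall>x \<in> U'. f x \<notin> range DStable \<and> c (f x) = l)"
    by (rule zykov_obstruction_descend[OF step.prems(1,2,4) arcs])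
  then obtain l U' where U': "U' \<subseteq> U" "zykov_obstruction E U'"
    "\<forall>x \<in> U'. f x \<notin> range DStable \<and> c (f x) = l"
    by blast
  have verts: "p \<in> DCopy l ` pverts D" if "p \<in> pverts ?D" "p \<notin> range DStable" "c p = l" for p
    using that by (auto simp: descartes_step_def Let_def c_def)
  have fU': "f x \<in> DCopy l ` pverts D" if "x \<in> U'" for x
    using that U' step.prems(3) by (intro verts) blast+
  have fx: "f x = DCopy l (d (f x))" "d (f x) \<in> pverts D" if "x \<in> U'" for x
    using fU'[OF that] by (auto simp: d_def)
  show False
  proof (rule step.IH)
    show "zykov_obstruction E U'"
      by fact
    show "inj_on (d \<circ> f) U'"
      using inj_on_subset[OF step.prems(2) U'(1)] fx(1)
      by (auto simp: inj_on_def) metis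
    show "(d \<circ> f) ` U' \<subseteq> pverts D"
      using fx by auto
    show "((d \<circ> f) x, (d \<circ> f) y) \<in> parcs D" if "x \<in> U'" "y \<in> U'" "(x, y) \<in> E" for x y
    proof -
      have "(DCopy l (d (f x)), DCopy l (d (f y))) \<in> parcs ?D"
        using step.prems(4)[of x y] fx that U'(1) by auto
      then show ?thesis
        by (auto simp: descartes_step_def Let_def)
    qed
  qed
qed

lemma iso_induced_subgraphE:
  assumes "iso_induced_subgraph G H"
  obtains f where "inj_on f (pverts G)" "f ` pverts G \<subseteq> pverts H"
    "\<And>x y. (x, y) \<in> parcs G \<Longrightarrow> (f x, f y) \<in> parcs H"
proof -
  obtain h where h: "pre_digraph.digraph_isomorphism (with_proj G) h"
    "induced_subgraph (app_iso h (with_proj G)) (with_proj H)"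
    using assms by (auto simp: iso_induced_subgraph_def digraph_iso_def)
  then have sub: "subgraph (app_iso h (with_proj G)) (with_proj H)"
    by auto
  show thesis
  proof (rule that[of "iso_verts h"])
    show "inj_on (iso_verts h) (pverts G)"
      using h(1) by (simp add: pre_digraph.digraph_isomorphism_def)
    show "iso_verts h ` pverts G \<subseteq> pverts H"
      using sub by (auto simp: subgraph_def)
    fix x y assume xy: "(x, y) \<in> parcs G"
    then have "iso_arcs h (x, y) \<in> parcs H"
      using sub by (auto simp: subgraph_def)
    \<comment> \<open>An isomorphism carries separate maps for arcs, tails and heads; compatibility
      with \<open>with_proj H\<close> turns the last two into projections, so the vertex map
      determines the arc map.\<close>
    moreover have "iso_tail h = fst \<and> iso_head h = snd" if "parcs G \<noteq> {}"
      using sub that by (auto simp: subgraph_def compatible_def)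
    then have "iso_arcs h (x, y) = (iso_verts h x, iso_verts h y)"
      using h(1) xy by (force simp: pre_digraph.digraph_isomorphism_def intro: prod_eqI)
    ultimately show "(iso_verts h x, iso_verts h y) \<in> parcs H"
      by simp
  qed
qed

lemma zykov_obstruction_imp_not_zykov_nor_descartes:
  assumes "zykov_obstruction (parcs G) U" "U \<subseteq> pverts G"
  shows "\<not> is_zykov_graph G" "\<not> is_blanche_descartes_graph G"
proof -
  have False if "iso_induced_subgraph G (zykov k)" for k
    using that
  proof (rule iso_induced_subgraphE)
    fix f assume f: "inj_on f (pverts G)" "f ` pverts G \<subseteq> pverts (zykov k)"
      "\<And>x y. (x, y) \<in> parcs G \<Longrightarrow> (f x, f y) \<in> parcs (zykov k)"
    then show False
      using assms not_zykov_obstruction_zykov[of "parcs G" U f k]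
      by (meson image_mono inj_on_subset order_trans)
  qed
  then show "\<not> is_zykov_graph G"
    by (auto simp: is_zykov_graph_def)
  have False if "descartes k D" "iso_induced_subgraph G D" for k D
    using that(2)
  proof (rule iso_induced_subgraphE)
    fix f assume f: "inj_on f (pverts G)" "f ` pverts G \<subseteq> pverts D"
      "\<And>x y. (x, y) \<in> parcs G \<Longrightarrow> (f x, f y) \<in> parcs D"
    then show False
      using assms not_zykov_obstruction_descartes[of k D "parcs G" U f] that(1)
      by (meson image_mono inj_on_subset order_trans)
  qed
  then show "\<not> is_blanche_descartes_graph G"
    by (auto simp: is_blanche_descartes_graph_def)
qed

section \<open>Obstructions in expanders\<close>

lemma card_unique_neighbour_edges_le:
  assumes "finite S" "finite K"
    and "\<And>v x y. v \<in> S \<Longrightarrow> x \<in> K \<Longrightarrow> y \<in> K \<Longrightarrow> (v, x) \<in> E \<Longrightarrow> (v, y) \<in> E \<Longrightarrow> x = y"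
  shows "card (E \<inter> S \<times> K) \<le> card S"
proof (rule card_inj_on_le[where f = fst])
  show "inj_on fst (E \<inter> S \<times> K)"
    using assms(3) by (auto simp: inj_on_def)
qed (use assms in auto)

text \<open>The size budget: \<open>W\<close> has fewer than \<open>q\<close> vertices,
  \<open>S\<close> fewer than \<open>2 * q\<close>, and the part of \<open>U - S\<close> outside the
  giant component fewer than \<open>q\<close>, so their union stays within the cap
  \<open>6 * q\<close> in \<open>sparse\<close>.\<close>

lemma zykov_obstruction_of_expander:
  fixes E :: "('a \<times> 'a) set"
  assumes V: "finite V" "19 * q \<le> card V" and q: "0 < q" and sym: "sym E"
    and dense: "\<And>A B. A \<subseteq> V \<Longrightarrow> B \<subseteq> V \<Longrightarrow> A \<inter> B = {} \<Longrightarrow> q \<le> card A \<Longrightarrow> q \<le> card B \<Longrightarrow>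
      E \<inter> A \<times> B \<noteq> {}"
  shows "\<exists>U \<subseteq> V. zykov_obstruction E U"
proof -
  define sparse where "sparse W \<longleftrightarrow> W \<subseteq> V \<and> card W \<le> 6 * q \<and> card (E \<inter> W \<times> (V - W)) \<le> card W" for W
  have fin: "finite X" if "X \<subseteq> V" for X
    using that V(1) finite_subset by blast
  have finE: "finite (E \<inter> X \<times> Y)" if "X \<subseteq> V" "Y \<subseteq> V" for X Y
    using that fin by auto
  have "finite {W. sparse W}"
    by (rule finite_subset[of _ "Pow V"]) (auto simp: sparse_def V(1))
  moreover have "{} \<in> {W. sparse W}"
    by (simp add: sparse_def)
  ultimately obtain W where W: "sparse W" and max: "\<And>W'. sparse W' \<Longrightarrow> W \<subseteq> W' \<Longrightarrow> W' = W"
    using finite_has_maximal[of "{W. sparse W}"] by blast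
  have WV: "W \<subseteq> V" "card W \<le> 6 * q" "card (E \<inter> W \<times> (V - W)) \<le> card W"
    using W by (auto simp: sparse_def)
  \<comment> \<open>If \<open>W\<close> had \<open>q\<close> vertices, fewer than \<open>q\<close>
    outside vertices would miss it, so more than \<open>19 * q - 6 * q - q = 12 * q\<close> edges
    would leave it, exceeding \<open>card W \<le> 6 * q\<close>.\<close>
  have cardW: "card W < q"
  proof (rule ccontr)
    assume "\<not> card W < q"
    define Z where "Z = {x \<in> V - W. E \<inter> W \<times> {x} = {}}"
    have "card Z < q"
      using dense[of W Z] WV \<open>\<not> card W < q\<close> by (force simp: Z_def)
    have "V - W - Z \<subseteq> snd ` (E \<inter> W \<times> (V - W))"
      by (force simp: Z_def)
    then have "card (V - W - Z) \<le> card (E \<inter> W \<times> (V - W))"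
      using finE[OF WV(1), of "V - W"] by (meson Diff_subset card_image_le card_mono finite_imageI le_trans)
    moreover have "card (V - W - Z) = card V - card W - card Z"
      using WV(1) fin[of W] fin[of Z] by (subst card_Diff_subset) (auto simp: Z_def card_Diff_subset)
    ultimately show False
      using WV \<open>card Z < q\<close> V(2) by linarith
  qed
  define U where "U = V - W"
  have U: "U \<subseteq> V" "18 * q \<le> card U"
    using cardW V WV by (auto simp: U_def card_Diff_subset fin)
  have "zykov_obstruction E U"
    unfolding zykov_obstruction_def
  proof (intro conjI allI impI)
    show "U \<noteq> {}"
      using U q by auto
    fix S assume S: "S \<subseteq> U" "S \<noteq> {}" "E \<inter> S \<times> S = {}"
    have cardS: "card S < 2 * q"
    proof (rule ccontr)
      assume "\<not> card S < 2 * q"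
      obtain A where A: "A \<subseteq> S" "card A = q"
        using \<open>\<not> card S < 2 * q\<close> by (rule_tac obtain_subset_with_card_n[of q S]) auto
      have "q \<le> card (S - A)"
        using A \<open>\<not> card S < 2 * q\<close> fin[of A] S(1) U(1) by (auto simp: card_Diff_subset)
      then show False
        using dense[of A "S - A"] A S U(1) by blast
    qed
    define T where "T = U - S"
    have T: "T \<subseteq> V" "16 * q \<le> card T"
      using cardS U S(1) fin[of S] by (auto simp: T_def card_Diff_subset)
    \<comment> \<open>These are the unions of components of \<open>U - S\<close> with at least
      \<open>q\<close> vertices in total; a minimal one turns out to be connected.\<close>
    define closed where "closed K \<longleftrightarrow> K \<subseteq> T \<and> E \<inter> K \<times> (T - K) = {} \<and> q \<le> card K" for K
    have "finite {K. closed K}"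
      by (rule finite_subset[of _ "Pow T"]) (auto simp: closed_def T(1) fin)
    moreover have "T \<in> {K. closed K}"
      using T(2) by (simp add: closed_def)
    ultimately obtain K where K: "closed K" and min: "\<And>K'. closed K' \<Longrightarrow> K' \<subseteq> K \<Longrightarrow> K' = K"
      using finite_has_minimal[of "{K. closed K}"] by blast
    have KT: "K \<subseteq> T" "E \<inter> K \<times> (T - K) = {}" "q \<le> card K"
      using K by (auto simp: closed_def)
    have rest: "card (T - K) < q"
      using dense[of K "T - K"] KT T(1) by fastforce
    have "15 * q \<le> card K"
      using rest T(2) KT(1) fin[of K] T(1) by (auto simp: card_Diff_subset)
    \<comment> \<open>Otherwise the part \<open>C\<close> reachable from \<open>x\<close> splits
      \<open>K\<close> without edges across. By minimality both parts have fewer than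
      \<open>q\<close> vertices, against \<open>15 * q \<le> card K\<close>.\<close>
    have conn: "(x, y) \<in> (Restr E T)\<^sup>*" if "x \<in> K" "y \<in> K" for x y
    proof (rule ccontr)
      assume nc: "(x, y) \<notin> (Restr E T)\<^sup>*"
      define C where "C = {z \<in> K. (x, z) \<in> (Restr E T)\<^sup>*}"
      have out: "E \<inter> C \<times> (T - C) = {}"
        using KT(1,2) by (auto simp: C_def dest: rtrancl_into_rtrancl)
      have "x \<in> C" "y \<notin> C"
        using that nc by (auto simp: C_def)
      have "card C < q"
      proof (rule ccontr)
        assume "\<not> card C < q"
        then have "closed C"
          using out KT(1) by (auto simp: closed_def C_def)
        then show False
          using min[of C] \<open>y \<notin> C\<close> that by (auto simp: C_def)
      qed
      moreover have "card (K - C) < q"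
      proof (rule ccontr)
        assume "\<not> card (K - C) < q"
        moreover have "E \<inter> (K - C) \<times> (T - (K - C)) = {}"
          using out KT(1,2) sym by (auto dest: symD)
        ultimately have "closed (K - C)"
          using KT(1) by (auto simp: closed_def)
        then show False
          using min[of "K - C"] \<open>x \<in> C\<close> that by auto
      qed
      moreover have "card (K - C) = card K - card C"
        using KT(1) T(1) fin[of C] by (intro card_Diff_subset) (auto simp: C_def)
      ultimately show False
        using \<open>15 * q \<le> card K\<close> by linarith
    qed
    show "\<exists>v\<in>S. \<exists>x\<in>U - S. \<exists>y\<in>U - S.
        x \<noteq> y \<and> (v, x) \<in> E \<and> (v, y) \<in> E \<and> (x, y) \<in> (Restr E (U - S))\<^sup>*"
    proof (rule ccontr)
      assume contra: "\<not> ?thesis"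
      have le: "card (E \<inter> S \<times> K) \<le> card S"
      proof (rule card_unique_neighbour_edges_le)
        show "finite S" "finite K"
          using S(1) U(1) KT(1) T(1) by (auto intro!: fin)
        show "x = y" if "v \<in> S" "x \<in> K" "y \<in> K" "(v, x) \<in> E" "(v, y) \<in> E" for v x y
          using contra that conn[of x y] KT(1) unfolding T_def by blast
      qed
      \<comment> \<open>This is the complement of \<open>K\<close>. Edges from it to
        \<open>K\<close> start in \<open>W\<close> or \<open>S\<close>, because \<open>K\<close> is
        closed in \<open>T\<close>. As \<open>S\<close> is nonempty, \<open>W'\<close> properly
        contains \<open>W\<close>.\<close>
      define W' where "W' = W \<union> S \<union> (T - K)"
      have sets: "V - W' = K" "W' \<subseteq> V"
        using KT(1) S(1) WV(1) by (auto simp: W'_def T_def U_def)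
      have "E \<inter> W' \<times> (V - W') \<subseteq> E \<inter> W \<times> (V - W) \<union> E \<inter> S \<times> K"
        using KT(1,2) sym S(1) unfolding sets(1) by (auto simp: W'_def T_def U_def dest: symD)
      then have "card (E \<inter> W' \<times> (V - W')) \<le> card (E \<inter> W \<times> (V - W) \<union> E \<inter> S \<times> K)"
        using S(1) U(1) KT(1) T(1) WV(1) by (intro card_mono finite_UnI finE) auto
      also have "\<dots> \<le> card W + card S"
        using card_Un_le[of "E \<inter> W \<times> (V - W)" "E \<inter> S \<times> K"] WV(3) le by linarith
      also have "\<dots> = card (W \<union> S)"
        using S(1) U(1) WV(1) fin by (subst card_Un_disjoint) (auto simp: U_def)
      also have "\<dots> \<le> card W'"
        using fin[OF sets(2)] by (intro card_mono) (auto simp: W'_def)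
      finally have "card (E \<inter> W' \<times> (V - W')) \<le> card W'" .
      moreover have "card W' \<le> card W + card S + card (T - K)"
        unfolding W'_def by (meson add_le_mono1 card_Un_le le_trans)
      then have "card W' \<le> 6 * q"
        using cardW cardS rest by linarith
      ultimately have "sparse W'"
        using sets(2) by (simp add: sparse_def)
      then have "W' = W"
        by (rule max) (auto simp: W'_def)
      then show False
        using S(1,2) by (auto simp: W'_def U_def)
    qed
  qed
  then show ?thesis
    using U(1) by blast
qed

section \<open>Sparse random graphs\<close>

definition cycle_edges :: "'a list \<Rightarrow> 'a set set" where
  "cycle_edges vs = (\<lambda>i. {vs ! i, vs ! (Suc i mod length vs)}) ` {..<length vs}"

lemma cycle_edges_subset_Pow: "cycle_edges vs \<subseteq> Pow (set vs)"
  by (auto simp: cycle_edges_def intro!: nth_mem mod_less_divisor)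

text \<open>If two positions gave the same pair, each would be the cyclic successor of the other,
  impossible from length 3 on. The exact count is the exponent in the probability that a cycle is
  present.\<close>

lemma card_cycle_edges:
  assumes "distinct vs" "3 \<le> length vs"
  shows "card (cycle_edges vs) = length vs"
proof -
  let ?n = "length vs"
  have "i = j" if "i < ?n" "j < ?n" "{vs ! i, vs ! (Suc i mod ?n)} = {vs ! j, vs ! (Suc j mod ?n)}" for i j
  proof (rule ccontr)
    assume "i \<noteq> j"
    have less: "Suc i mod ?n < ?n" "Suc j mod ?n < ?n"
      using that by (auto intro: mod_less_divisor)
    then have "i = Suc j mod ?n" "j = Suc i mod ?n"
      using that \<open>i \<noteq> j\<close> assms(1) by (auto simp: doubleton_eq_iff nth_eq_iff_index_eq)
    moreover have "Suc k mod ?n = (if Suc k = ?n then 0 else Suc k)" if "k < ?n" for k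
      using that by (simp add: mod_Suc)
    ultimately show False
      using that(1,2) assms(2) by (auto split: if_splits)
  qed
  then have "inj_on (\<lambda>i. {vs ! i, vs ! (Suc i mod ?n)}) {..<?n}"
    by (auto simp: inj_on_def)
  then show ?thesis
    by (simp add: cycle_edges_def card_image)
qed

text \<open>
  The random graph is given by a uniformly random \<open>f\<close> from the sets of vertices to \<open>{..<M}\<close>, with \<open>e\<close>
  an edge if \<open>f e = 0\<close>. Sets that are not pairs are irrelevant; keeping them avoids a side condition.
\<close>

lemma card_PiE_constrained:
  assumes "finite P" "Q \<subseteq> P" "B \<subseteq> {..<M}" "0 < M"
  shows "real (card {f \<in> P \<rightarrow>\<^sub>E {..<M}. \<forall>e \<in> Q. f e \<in> B})
    = (real (card B) / real M) ^ card Q * real (card (P \<rightarrow>\<^sub>E {..<M}))"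
proof -
  \<comment> \<open>The constraint is coordinatewise, so the constrained functions again form a
    product.\<close>
  have "{f \<in> P \<rightarrow>\<^sub>E {..<M}. \<forall>e \<in> Q. f e \<in> B} = (\<Pi>\<^sub>E e\<in>P. if e \<in> Q then B else {..<M})"
    using assms by (fastforce simp: PiE_def Pi_def split: if_splits)
  then have "card {f \<in> P \<rightarrow>\<^sub>E {..<M}. \<forall>e \<in> Q. f e \<in> B} = (\<Prod>e\<in>P. if e \<in> Q then card B else M)"
    using assms(1) by (auto simp: card_PiE intro!: prod.cong)
  also have "\<dots> = card B ^ card Q * M ^ card (P - Q)"
    using assms by (simp add: prod.If_cases Int_absorb1 Diff_eq)
  moreover have "card (P \<rightarrow>\<^sub>E {..<M}) = M ^ card Q * M ^ card (P - Q)"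
    using assms by (simp add: card_PiE finite_subset card_mono card_Diff_subset flip: power_add)
  ultimately show ?thesis
    using assms(4) by (simp add: power_divide)
qed

section \<open>Expected number of short cycles\<close>

definition short_cycles :: "nat \<Rightarrow> nat \<Rightarrow> nat set set \<Rightarrow> nat list set" where
  "short_cycles n g X = {vs. set vs \<subseteq> {..<n} \<and> distinct vs \<and> 3 \<le> length vs \<and> length vs < g \<and> cycle_edges vs \<subseteq> X}"

lemma sum_powers_le:
  assumes "2 \<le> c"
  shows "(\<Sum>j<g. c ^ j) \<le> (c :: real) ^ g"
proof (induction g)
  case (Suc g)
  have "(\<Sum>j<Suc g. c ^ j) \<le> 2 * c ^ g"
    using Suc by simp
  also have "\<dots> \<le> c ^ Suc g"
    using assms by (simp add: mult_right_mono)
  finally show ?case .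
qed simp

lemma finite_bounded_lists: "finite {vs. set vs \<subseteq> {..<n::nat} \<and> length vs < g}"
  by (rule finite_subset[OF _ finite_lists_length_le[of "{..<n}" g]]) auto

lemma sum_bounded_lists:
  fixes h :: "nat \<Rightarrow> real"
  shows "(\<Sum>vs | set vs \<subseteq> {..<n::nat} \<and> length vs < g. h (length vs)) = (\<Sum>j<g. real n ^ j * h j)"
proof -
  have "{vs. set vs \<subseteq> {..<n} \<and> length vs < g} = (\<Union>j<g. {vs. set vs \<subseteq> {..<n} \<and> length vs = j})"
    by auto
  then have "(\<Sum>vs | set vs \<subseteq> {..<n} \<and> length vs < g. h (length vs))
      = (\<Sum>j<g. \<Sum>vs | set vs \<subseteq> {..<n} \<and> length vs = j. h (length vs))"
    by (simp only:) (subst sum.UNION_disjoint, auto simp: finite_lists_length_eq)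
  also have "\<dots> = (\<Sum>j<g. real n ^ j * h j)"
    by (intro sum.cong) (simp_all add: card_lists_length_eq)
  finally show ?thesis .
qed

text \<open>First-moment method, with expectations written as sums over all \<open>f\<close>: a list
  of length \<open>j\<close> is present for a fraction \<open>(1 / M) ^ j\<close> of the functions,
  and at most \<open>(c * M) ^ j\<close> lists contribute \<open>c ^ j\<close>. A cycle is counted
  once per starting point and orientation, which is harmless for an upper bound.\<close>

lemma sum_card_short_cycles_le:
  fixes c M g :: nat
  defines "F \<equiv> Pow {..<c * M} \<rightarrow>\<^sub>E {..<M}"
  assumes "0 < M" "2 \<le> c"
  shows "(\<Sum>f\<in>F. real (card (short_cycles (c * M) g {e. f e = 0}))) \<le> real c ^ g * real (card F)"
proof -
  let ?n = "c * M"
  define L where "L = {vs. set vs \<subseteq> {..<?n} \<and> distinct vs \<and> 3 \<le> length vs \<and> length vs < g}"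
  have L: "L \<subseteq> {vs. set vs \<subseteq> {..<?n} \<and> length vs < g}"
    by (auto simp: L_def)
  have finL: "finite L"
    using L finite_bounded_lists by (rule finite_subset)
  have finF: "finite F"
    unfolding F_def by (intro finite_PiE) auto
  have "(\<Sum>f\<in>F. real (card (short_cycles ?n g {e. f e = 0})))
      = (\<Sum>f\<in>F. \<Sum>vs\<in>L. of_bool (\<forall>e\<in>cycle_edges vs. f e = 0))"
  proof (rule sum.cong[OF refl])
    fix f
    have "short_cycles ?n g {e. f e = 0} = {vs \<in> L. \<forall>e\<in>cycle_edges vs. f e = 0}"
      by (auto simp: short_cycles_def L_def)
    then show "real (card (short_cycles ?n g {e. f e = 0}))
        = (\<Sum>vs\<in>L. of_bool (\<forall>e\<in>cycle_edges vs. f e = 0))"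
      using finL by (simp add: sum.If_cases of_bool_def Int_def)
  qed
  also have "\<dots> = (\<Sum>vs\<in>L. \<Sum>f\<in>F. of_bool (\<forall>e\<in>cycle_edges vs. f e = 0))"
    by (rule sum.swap)
  also have "\<dots> = (\<Sum>vs\<in>L. (1 / real M) ^ length vs * real (card F))"
  proof (rule sum.cong[OF refl])
    fix vs assume vs: "vs \<in> L"
    then have "cycle_edges vs \<subseteq> Pow {..<?n}" "card (cycle_edges vs) = length vs"
      using cycle_edges_subset_Pow[of vs] card_cycle_edges[of vs] by (auto simp: L_def)
    then have "real (card {f \<in> F. \<forall>e\<in>cycle_edges vs. f e \<in> {0}}) = (1 / real M) ^ length vs * real (card F)"
      using card_PiE_constrained[of "Pow {..<?n}" "cycle_edges vs" "{0}" M] assms(2) by (simp add: F_def)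
    then show "(\<Sum>f\<in>F. of_bool (\<forall>e\<in>cycle_edges vs. f e = 0)) = (1 / real M) ^ length vs * real (card F)"
      using finF by (simp add: sum.If_cases of_bool_def Int_def)
  qed
  also have "\<dots> = (\<Sum>vs\<in>L. (1 / real M) ^ length vs) * real (card F)"
    by (simp add: sum_distrib_right)
  also have "\<dots> \<le> real c ^ g * real (card F)"
  proof (rule mult_right_mono)
    have "(\<Sum>vs\<in>L. (1 / real M) ^ length vs)
        \<le> (\<Sum>vs | set vs \<subseteq> {..<?n} \<and> length vs < g. (1 / real M) ^ length vs)"
      using L finite_bounded_lists by (intro sum_mono2) auto
    also have "\<dots> = (\<Sum>j<g. real c ^ j)"
      unfolding sum_bounded_lists using assms(2) by (intro sum.cong) (simp_all flip: power_mult_distrib)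
    also have "\<dots> \<le> real c ^ g"
      using assms(3) by (intro sum_powers_le) simp
    finally show "(\<Sum>vs\<in>L. (1 / real M) ^ length vs) \<le> real c ^ g" .
  qed simp
  finally show ?thesis .
qed

section \<open>Probability of an unjoined pair of sets\<close>

lemma one_minus_inverse_power_le_half:
  assumes "0 < M"
  shows "(1 - 1 / real M) ^ M \<le> 1 / 2"
proof -
  have "1 - 1 / real M \<le> exp (- (1 / real M))"
    using exp_ge_add_one_self[of "- (1 / real M)"] by simp
  then have "(1 - 1 / real M) ^ M \<le> exp (- (1 / real M)) ^ M"
    using assms by (intro power_mono) auto
  also have "\<dots> = inverse (exp 1)"
    using assms by (simp only: exp_of_nat_mult[symmetric]) (simp add: exp_minus)
  also have "\<dots> \<le> inverse 2"
    using exp_ge_add_one_self[of 1] by (intro le_imp_inverse_le) simp_all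
  finally show ?thesis
    by simp
qed

definition unjoined_pairs :: "nat \<Rightarrow> nat \<Rightarrow> nat set set \<Rightarrow> (nat set \<times> nat set) set" where
  "unjoined_pairs n q X = {(A, B). A \<subseteq> {..<n} \<and> B \<subseteq> {..<n} \<and> A \<inter> B = {} \<and> card A = q \<and> card B = q
    \<and> (\<forall>a\<in>A. \<forall>b\<in>B. {a, b} \<notin> X)}"

text \<open>Union bound over at most \<open>4 ^ n\<close> pairs of subsets. Disjointness makes the
  \<open>q * q\<close> pairs across \<open>A\<close> and \<open>B\<close> distinct coordinates of
  \<open>f\<close>, independently nonzero with probability \<open>1 - 1 / M\<close> each.\<close>

lemma card_unjoined_pairs_nonempty_le:
  fixes n q M :: nat
  defines "F \<equiv> Pow {..<n} \<rightarrow>\<^sub>E {..<M}"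
  assumes "0 < M"
  shows "real (card {f \<in> F. unjoined_pairs n q {e. f e = 0} \<noteq> {}})
    \<le> 4 ^ n * (1 - 1 / real M) ^ (q * q) * real (card F)"
proof -
  define R where "R = {(A, B). A \<subseteq> {..<n} \<and> B \<subseteq> {..<n} \<and> A \<inter> B = {} \<and> card A = q \<and> card B = q}"
  define bad where "bad = (\<lambda>(A, B). {f \<in> F. \<forall>a\<in>A. \<forall>b\<in>B. f {a, b} \<noteq> 0})"
  have finF: "finite F"
    unfolding F_def by (intro finite_PiE) auto
  have R: "R \<subseteq> Pow {..<n} \<times> Pow {..<n}"
    by (auto simp: R_def)
  have finR: "finite R"
    using R by (rule finite_subset) simp
  have "card R \<le> card (Pow {..<n} \<times> Pow {..<n})"
    using R by (rule card_mono[rotated]) simp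
  also have "\<dots> = 4 ^ n"
    by (simp add: card_cartesian_product card_Pow flip: power_mult_distrib)
  finally have cardR: "real (card R) \<le> 4 ^ n"
    by (metis of_nat_le_iff of_nat_numeral of_nat_power)
  have card_bad: "real (card (bad p)) = (1 - 1 / real M) ^ (q * q) * real (card F)" if "p \<in> R" for p
  proof -
    obtain A B where p: "p = (A, B)"
      by (cases p)
    then have AB: "A \<subseteq> {..<n}" "B \<subseteq> {..<n}" "A \<inter> B = {}" "card A = q" "card B = q"
      using that by (auto simp: R_def)
    define Q where "Q = (\<lambda>(a, b). {a, b}) ` (A \<times> B)"
    have "inj_on (\<lambda>(a, b). {a, b}) (A \<times> B)"
      using AB(3) by (auto simp: inj_on_def doubleton_eq_iff)
    then have "card Q = q * q"
      using AB by (simp add: Q_def card_image card_cartesian_product)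
    moreover have "Q \<subseteq> Pow {..<n}"
      using AB by (auto simp: Q_def)
    moreover have "f e < M" if "f \<in> F" "e \<in> Q" for f e
      using that \<open>Q \<subseteq> Pow {..<n}\<close> PiE_mem[of f "Pow {..<n}" "\<lambda>_. {..<M}" e] by (auto simp: F_def)
    then have "bad p = {f \<in> F. \<forall>e\<in>Q. f e \<in> {0<..<M}}"
      by (auto simp: bad_def Q_def p)
    moreover have "real (card {0<..<M}) / real M = 1 - 1 / real M"
      using assms(2) by (simp add: field_simps of_nat_diff)
    moreover have "{0<..<M} \<subseteq> {..<M}"
      by auto
    ultimately show ?thesis
      using card_PiE_constrained[of "Pow {..<n}" Q "{0<..<M}" M] assms(2) by (auto simp: F_def)
  qed
  have "{f \<in> F. unjoined_pairs n q {e. f e = 0} \<noteq> {}} \<subseteq> (\<Union>p\<in>R. bad p)"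
  proof
    fix f assume f: "f \<in> {f \<in> F. unjoined_pairs n q {e. f e = 0} \<noteq> {}}"
    then obtain A B where "(A, B) \<in> unjoined_pairs n q {e. f e = 0}"
      by auto
    then have "(A, B) \<in> R" "f \<in> bad (A, B)"
      using f by (simp_all add: unjoined_pairs_def R_def bad_def)
    then show "f \<in> (\<Union>p\<in>R. bad p)"
      by blast
  qed
  then have "real (card {f \<in> F. unjoined_pairs n q {e. f e = 0} \<noteq> {}}) \<le> real (card (\<Union>p\<in>R. bad p))"
    using finR finF by (intro of_nat_mono card_mono) (auto simp: bad_def)
  also have "\<dots> \<le> (\<Sum>p\<in>R. real (card (bad p)))"
    using card_UN_le[OF finR, of bad] by (metis of_nat_le_iff of_nat_sum)
  also have "\<dots> = real (card R) * ((1 - 1 / real M) ^ (q * q) * real (card F))"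
    using card_bad by simp
  also have "\<dots> \<le> 4 ^ n * ((1 - 1 / real M) ^ (q * q) * real (card F))"
    using cardR assms(2) by (intro mult_right_mono) auto
  finally show ?thesis
    by (simp add: mult.assoc)
qed

text \<open>
  With \<open>n = 840 M\<close> and \<open>q = 42 M\<close>, the expected number of unjoined pairs is at most
  \<open>4\<^sup>n (1 - 1/M) ^ q\<^sup>2 \<le> 2 ^ (1680 M - 1764 M)\<close>. The expected number of short cycles is at most \<open>840\<^sup>g\<close>, so
  there are fewer than \<open>M = 2 \<cdot> 840\<^sup>g\<close> of them with probability at least one half.
\<close>

lemma exists_joined_edge_set_few_short_cycles:
  fixes g :: nat
  defines "M \<equiv> 2 * 840 ^ g"
  shows "\<exists>X. card (short_cycles (840 * M) g X) < M \<and> unjoined_pairs (840 * M) (42 * M) X = {}"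
proof -
  \<comment> \<open>The ratio \<open>n = 20 * q\<close> leaves room to delete \<open>M\<close>
    vertices and keep \<open>19 * q\<close>. The union bound then wants
    \<open>q * q > 2 * n * M\<close>, that is \<open>q > 40 * M\<close>.\<close>
  let ?n = "840 * M" and ?q = "42 * M"
  define F where "F = Pow {..<?n} \<rightarrow>\<^sub>E {..<M}"
  define A where "A = {f \<in> F. M \<le> card (short_cycles ?n g {e. f e = 0})}"
  define B where "B = {f \<in> F. unjoined_pairs ?n ?q {e. f e = 0} \<noteq> {}}"
  have M: "0 < M"
    by (simp add: M_def)
  have finF: "finite F"
    unfolding F_def by (intro finite_PiE) auto
  have "F \<noteq> {}"
    using M by (auto simp: F_def PiE_eq_empty_iff)
  then have F0: "0 < card F"
    using finF by (simp add: card_gt_0_iff)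
  \<comment> \<open>Markov's inequality, cleared of denominators.\<close>
  have "real (card A) * real M = (\<Sum>f\<in>A. real M)"
    by simp
  also have "\<dots> \<le> (\<Sum>f\<in>A. real (card (short_cycles ?n g {e. f e = 0})))"
    by (intro sum_mono) (simp add: A_def)
  also have "\<dots> \<le> (\<Sum>f\<in>F. real (card (short_cycles ?n g {e. f e = 0})))"
    using finF by (intro sum_mono2) (auto simp: A_def)
  also have "\<dots> \<le> real 840 ^ g * real (card F)"
    unfolding F_def using M by (intro sum_card_short_cycles_le) simp_all
  finally have "2 * real (card A) \<le> real (card F)"
    by (simp add: M_def)
  moreover have "4 * real (card B) \<le> real (card F)"
  proof -
    have "(1 - 1 / real M) ^ (?q * ?q) = ((1 - 1 / real M) ^ M) ^ (1764 * M)"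
      by (simp add: mult_ac flip: power_mult)
    also have "\<dots> \<le> (1 / 2) ^ (1764 * M)"
      using M by (intro power_mono one_minus_inverse_power_le_half) (auto simp: field_simps)
    finally have "4 ^ ?n * (1 - 1 / real M) ^ (?q * ?q) \<le> 4 ^ ?n * (1 / 2) ^ (1764 * M)"
      by simp
    also have "\<dots> = (1 / 2) ^ (84 * M)"
    proof -
      have "4 ^ m * (1 / 2) ^ (2 * m + k) = (1 / 2 :: real) ^ k" for m k
        by (simp add: power_add power_mult power2_eq_square flip: power_mult_distrib)
      from this[of ?n "84 * M"] show ?thesis
        by simp
    qed
    also have "\<dots> \<le> (1 / 2) ^ 2"
      using M by (intro power_decreasing) auto
    finally have "4 ^ ?n * (1 - 1 / real M) ^ (?q * ?q) * real (card F) \<le> 1 / 4 * real (card F)"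
      by (intro mult_right_mono) (simp_all add: power2_eq_square)
    then show ?thesis
      using card_unjoined_pairs_nonempty_le[OF M, of ?n ?q] unfolding B_def F_def by linarith
  qed
  \<comment> \<open>The bad events have probability at most \<open>1 / 2\<close> and
    \<open>1 / 4\<close>.\<close>
  ultimately have "card (A \<union> B) < card F"
    using F0 card_Un_le[of A B] by linarith
  moreover have "finite (A \<union> B)"
    using finF by (auto simp: A_def B_def)
  ultimately have "\<not> F \<subseteq> A \<union> B"
    using card_mono[of "A \<union> B" F] by auto
  then show ?thesis
    by (fastforce simp: A_def B_def not_le)
qed

text \<open>Translates arc-walk cycles into the vertex lists counted above: the heads of the arcs,
  read in order, run once around the cycle.\<close>

lemma cycle_imp_cycle_edges:
  assumes "pair_graph G" "pre_digraph.cycle (with_proj G) p"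
  shows "distinct (map snd p)" "set (map snd p) \<subseteq> pverts G"
    and "cycle_edges (map snd p) \<subseteq> (\<lambda>(x, y). {x, y}) ` parcs G"
proof -
  interpret pair_graph G by fact
  obtain u where u: "awalk u p u" "distinct (tl (awalk_verts u p))" "p \<noteq> []"
    using assms(2) by (auto simp: cycle_def)
  have cas: "cas u p u" and arcs: "set p \<subseteq> parcs G"
    using u(1) by (auto simp: awalk_def)
  show "distinct (map snd p)"
    using u(2,3) awalk_verts_conv'[OF cas] by simp
  show "set (map snd p) \<subseteq> pverts G"
    using arcs pair_graphD(2)[OF assms(1)] by fastforce
  have verts: "map fst p @ [snd (last p)] = fst (hd p) # map snd p"
    using u(3) awalk_verts_conv[of u p] awalk_verts_conv'[OF cas] by simp
  have wrap: "fst (p ! 0) = snd (last p)"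
    using u(3) awhd_if_cas[OF cas] awlast_if_cas[OF cas]
    by (simp add: awalk_verts_conv hd_append hd_map hd_conv_nth)
  have "{map snd p ! i, map snd p ! (Suc i mod length p)} \<in> (\<lambda>(x, y). {x, y}) ` parcs G"
    if "i < length p" for i
  proof -
    \<comment> \<open>The heads of arcs \<open>i\<close> and \<open>?j\<close> are the two ends of
      arc \<open>?j\<close>, not of arc \<open>i\<close>.\<close>
    let ?j = "Suc i mod length p"
    have j: "?j < length p"
      using that u(3) by simp
    have "fst (p ! ?j) = snd (p ! i)"
    proof (cases "Suc i = length p")
      case True
      then have "last p = p ! i"
        using u(3) by (metis diff_Suc_1 last_conv_nth)
      then show ?thesis
        using wrap True by simp
    next
      case False
      then have "Suc i < length p"
        using that by simp
      then show ?thesis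
        using arg_cong[OF verts, of "\<lambda>xs. xs ! Suc i"] by (simp add: nth_append)
    qed
    then have "{map snd p ! i, map snd p ! ?j} = (\<lambda>(x, y). {x, y}) (p ! ?j)"
      using that j by (simp add: case_prod_beta)
    moreover have "p ! ?j \<in> parcs G"
      using arcs j by (meson nth_mem subsetD)
    ultimately show ?thesis
      by (rule image_eqI)
  qed
  then show "cycle_edges (map snd p) \<subseteq> (\<lambda>(x, y). {x, y}) ` parcs G"
    by (auto simp: cycle_edges_def)
qed

section \<open>Deleting a vertex from each short cycle\<close>

theorem theorem9:
  fixes g :: int
  shows "\<exists>G :: nat pair_pre_digraph.
    pair_graph G \<and> enat (nat g) \<le> girth G \<and> \<not> is_zykov_graph G \<and> \<not> is_blanche_descartes_graph G"
proof -
  \<comment> \<open>A negative \<open>g\<close> becomes \<open>nat g = 0\<close>, where the girth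
    bound is trivial.\<close>
  define M :: nat where "M = 2 * 840 ^ nat g"
  let ?n = "840 * M" and ?q = "42 * M"
  obtain X where X: "card (short_cycles ?n (nat g) X) < M" "unjoined_pairs ?n ?q X = {}"
    using exists_joined_edge_set_few_short_cycles[of "nat g"] unfolding M_def by blast
  define C where "C = short_cycles ?n (nat g) X"
  have finC: "finite C"
    by (rule finite_subset[OF _ finite_bounded_lists[of ?n "nat g"]]) (auto simp: C_def short_cycles_def)
  define V where "V = {..<?n} - hd ` C"
  define G where "G = \<lparr>pverts = V, parcs = {(x, y). x \<in> V \<and> y \<in> V \<and> x \<noteq> y \<and> {x, y} \<in> X}\<rparr>"
  have G: "pair_graph G"
    by (rule pair_graphI) (auto simp: G_def V_def insert_commute)
  have "?n - card (hd ` C) \<le> card V"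
    using diff_card_le_card_Diff[of "hd ` C" "{..<?n}"] finC by (simp add: V_def)
  moreover have "card (hd ` C) < M"
    using X(1) card_image_le[OF finC, of hd] by (simp add: C_def)
  \<comment> \<open>More than \<open>839 * M\<close> vertices survive, and
    \<open>19 * 42 * M = 798 * M\<close>.\<close>
  ultimately have cardV: "19 * ?q \<le> card V"
    by linarith
  have "\<exists>U \<subseteq> V. zykov_obstruction (parcs G) U"
  proof (rule zykov_obstruction_of_expander)
    show "finite V" "19 * ?q \<le> card V" "0 < ?q"
      using cardV by (auto simp: V_def M_def)
    show "sym (parcs G)"
      by (auto simp: G_def sym_def insert_commute)
    fix A B assume AB: "A \<subseteq> V" "B \<subseteq> V" "A \<inter> B = {}" "?q \<le> card A" "?q \<le> card B"
    obtain A' B' where A': "A' \<subseteq> A" "card A' = ?q" and B': "B' \<subseteq> B" "card B' = ?q"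
      using AB(4,5) by (meson obtain_subset_with_card_n)
    have "(A', B') \<notin> unjoined_pairs ?n ?q X"
      by (simp add: X(2))
    then obtain a b where ab: "a \<in> A'" "b \<in> B'" "{a, b} \<in> X"
      using AB A' B' by (auto simp: unjoined_pairs_def V_def)
    then have "(a, b) \<in> parcs G \<inter> A \<times> B"
      using AB A'(1) B'(1) by (auto simp: G_def)
    then show "parcs G \<inter> A \<times> B \<noteq> {}"
      by blast
  qed
  then have "\<not> is_zykov_graph G" "\<not> is_blanche_descartes_graph G"
    using zykov_obstruction_imp_not_zykov_nor_descartes[of G] by (auto simp: G_def)
  moreover have "enat (nat g) \<le> girth G"
    unfolding girth_def
  proof (rule INF_greatest)
    fix p assume "p \<in> {p. pre_digraph.cycle (with_proj G) p \<and> 3 \<le> length p}"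
    then have p: "pre_digraph.cycle (with_proj G) p" "3 \<le> length p"
      by auto
    have verts: "set (map snd p) \<subseteq> V"
      using cycle_imp_cycle_edges(2)[OF G p(1)] by (simp add: G_def)
    have "nat g \<le> length p"
    \<comment> \<open>A shorter cycle would give a list in \<open>C\<close>, whose first vertex was
      deleted.\<close>
    proof (rule ccontr)
      assume "\<not> nat g \<le> length p"
      moreover have "cycle_edges (map snd p) \<subseteq> X"
        using cycle_imp_cycle_edges(3)[OF G p(1)] by (auto simp: G_def)
      ultimately have "map snd p \<in> C"
        using p(2) verts cycle_imp_cycle_edges(1)[OF G p(1)]
        by (auto simp: C_def short_cycles_def V_def)
      then have "hd (map snd p) \<notin> V"
        by (auto simp: V_def)
      moreover have "hd (map snd p) \<in> set (map snd p)"
        using p(2) by (intro hd_in_set) auto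
      ultimately show False
        using verts by blast
    qed
    then show "enat (nat g) \<le> enat (length p)"
      by simp
  qed
  ultimately show ?thesis
    using G by blast
qed

end
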